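(* For every $m,n,\delta\in\mathbb{N}$ such that $\delta\mid mn$, the number $s_\delta(m,n)$ of subgroups of order $\delta$ of the group $\mathbb{Z}_m\times\mathbb{Z}_n$ is $$s_{\delta}(m,n)=\sum_{\substack{i\mid \gcd(m,\delta)\\ j\mid \gcd(n,\delta)\\ \delta\mid ij}}\phi\left(\frac{ij}{\delta}\right).$$
   Context: $\mathbb{N}=\{1,2,\ldots\}$. $\mathbb{Z}_m$ denotes the additive group of residue classes modulo $m$. $\phi$ is Euler's totient function. The sum runs over pairs $(i,j)$ of positive integers satisfying the listed divisibility conditions. *)

theory Defs
  imports "HOL-Algebra.Algebra" "HOL-Number_Theory.Totient"
begin

definition subgroup_count :: "nat \<Rightarrow> nat \<Rightarrow> nat \<Rightarrow> nat" where
  "subgroup_count \<delta> m n =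
     card {H. subgroup H (integer_mod_group m \<times>\<times> integer_mod_group n) \<and> card H = \<delta>}"

end

theory Submission
  imports Defs
begin

text \<open>
  A subgroup \<open>H\<close> lifts to a lattice in \<open>\<int> \<times> \<int>\<close> containing \<open>m\<int> \<times> n\<int>\<close>. If its two
  coordinate projections are \<open>a\<int>\<close> and \<open>b\<int>\<close>, the lattice consists of the pairs \<open>(x a, y b)\<close>
  with \<open>y \<equiv> u x\<close> modulo \<open>d\<close> for some \<open>d\<close> and some unit \<open>u\<close> modulo \<open>d\<close>. With \<open>i = m / a\<close> and
  \<open>j = n / b\<close>, the orders of the projections of \<open>H\<close>, both divisible by \<open>d\<close>, the order of \<open>H\<close>
  is \<open>i j / d\<close>. So for order \<open>\<delta>\<close> the pair \<open>(i, j)\<close> forces \<open>d = i j / \<delta>\<close>, and the totient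
  counts the choices of \<open>u\<close>.
\<close>

section \<open>Subgroups of the integers\<close>

text \<open>Division with remainder by the least positive element: a nonzero remainder would be a
  smaller positive element. The member \<open>M\<close> excludes the zero subgroup, so the generator
  is positive.\<close>

lemma int_closed_diff_multiples:
  fixes A :: "int set"
  assumes diff: "\<And>x y. x \<in> A \<Longrightarrow> y \<in> A \<Longrightarrow> x - y \<in> A"
    and M: "M \<in> A" "M > 0"
  shows "\<exists>g>0. A = {x. g dvd x}"
proof -
  have z: "0 \<in> A" using diff[OF M(1) M(1)] by simp
  have neg: "- x \<in> A" if "x \<in> A" for x using diff[OF z that] by simp
  have add: "x + y \<in> A" if "x \<in> A" "y \<in> A" for x y
    using diff[OF that(1) neg[OF that(2)]] by simp
  have nmult: "int k * x \<in> A" if "x \<in> A" for k x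
    by (induction k) (use z add that in \<open>auto simp: algebra_simps\<close>)
  have mult: "k * x \<in> A" if "x \<in> A" for k x
    using nmult[OF that, of "nat k"] neg[OF nmult[OF that, of "nat (- k)"]]
    by (cases "k \<ge> 0") auto
  define g where "g = (LEAST k. k > 0 \<and> int k \<in> A)"
  have "nat M > 0 \<and> int (nat M) \<in> A" using M by simp
  then have g: "g > 0 \<and> int g \<in> A" unfolding g_def by (rule LeastI)
  have "int g dvd x" if x: "x \<in> A" for x
  proof (rule ccontr)
    assume "\<not> int g dvd x"
    then have "x mod int g > 0"
      using g pos_mod_sign[of "int g" x] by (metis dvd_eq_mod_eq_0 of_nat_0_less_iff order_le_imp_less_or_eq)
    moreover have "x mod int g \<in> A"
      using diff[OF x mult[of "int g" "x div int g"]] g by (simp only: minus_div_mult_eq_mod)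
    ultimately have "g \<le> nat (x mod int g)"
      unfolding g_def by (intro Least_le) auto
    with g show False
      using pos_mod_bound[of "int g" x] by linarith
  qed
  moreover have "x \<in> A" if "int g dvd x" for x
    using that mult g by (metis dvd_def mult.commute)
  ultimately have "A = {x. int g dvd x}" by blast
  then show ?thesis
    using g of_nat_0_less_iff by blast
qed

section \<open>Lattices in the integer plane\<close>

text \<open>When \<open>u\<close> is a unit modulo \<open>d\<close>, the congruence is the gluing
  datum of Goursat's lemma: the graph of multiplication by \<open>u\<close> on the residues modulo
  \<open>d\<close>. Coordinates are measured in units of \<open>a\<close> and
  \<open>b\<close>.\<close>

definition int_lattice :: "int \<Rightarrow> int \<Rightarrow> int \<Rightarrow> int \<Rightarrow> (int \<times> int) set" where
  "int_lattice a b d u = {(x * a, y * b) |x y. d dvd y - u * x}"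

lemma int_lattice_diff:
  assumes "(p, q) \<in> int_lattice a b d u" "(p', q') \<in> int_lattice a b d u"
  shows "(p - p', q - q') \<in> int_lattice a b d u"
proof -
  obtain x y x' y' where "p = x * a" "q = y * b" "d dvd y - u * x"
      "p' = x' * a" "q' = y' * b" "d dvd y' - u * x'"
    using assms unfolding int_lattice_def by blast
  moreover from this have "d dvd (y - y') - u * (x - x')"
    by (smt (verit, ccfv_SIG) dvd_diff right_diff_distrib)
  ultimately show ?thesis
    unfolding int_lattice_def by (auto simp: left_diff_distrib[symmetric])
qed

text \<open>With \<open>m = i * a\<close> and \<open>n = j * b\<close>, these are the points that
  vanish in the quotient group. Their presence lets the lattice descend to residues.\<close>

lemma int_lattice_periods:
  assumes "d dvd i" "d dvd j"
  shows "(k * (i * a), l * (j * b)) \<in> int_lattice a b d u"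
proof -
  have "d dvd l * j - u * (k * i)" using assms by simp
  then show ?thesis
    unfolding int_lattice_def by (force simp: mult.assoc)
qed

lemma int_lattice_mod:
  assumes "d dvd i" "d dvd j" "(p, q) \<in> int_lattice a b d u"
  shows "(p mod (i * a), q mod (j * b)) \<in> int_lattice a b d u"
  using int_lattice_diff[OF assms(3) int_lattice_periods[OF assms(1,2), of "p div (i * a)" a "q div (j * b)" b u]]
  by (simp add: minus_div_mult_eq_mod)

text \<open>Reduction changes a point only by a period, so the lattice can be recovered from its
  points in the box of representatives.\<close>

lemma int_lattice_mod_iff:
  assumes "d dvd i" "d dvd j"
  shows "(p mod (i * a), q mod (j * b)) \<in> int_lattice a b d u \<longleftrightarrow> (p, q) \<in> int_lattice a b d u"
proof
  assume h: "(p mod (i * a), q mod (j * b)) \<in> int_lattice a b d u"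
  show "(p, q) \<in> int_lattice a b d u"
    using int_lattice_diff[OF h int_lattice_periods[OF assms, of "- (p div (i * a))" a "- (q div (j * b))" b u]]
    by (simp only: mult_minus_left diff_minus_eq_add mod_div_mult_eq)
qed (rule int_lattice_mod[OF assms])

lemma int_lattice_cong:
  assumes "d dvd u - v"
  shows "int_lattice a b d u = int_lattice a b d v"
proof -
  have "d dvd y - u * x \<longleftrightarrow> d dvd y - v * x" for x y
  proof -
    have "y - v * x = (y - u * x) + (u - v) * x" by (simp add: algebra_simps)
    then show ?thesis using assms by (metis dvd_add_left_iff dvd_mult2)
  qed
  then show ?thesis unfolding int_lattice_def by simp
qed

text \<open>The numbers \<open>a\<close> and \<open>b\<close> are recovered as the positive
  generators of the two projections. The point \<open>(a, u * b)\<close> then reveals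
  \<open>u\<close> modulo \<open>d\<close>.\<close>

lemma int_lattice_eqD:
  assumes eq: "int_lattice a b d u = int_lattice a' b' d' v"
    and cop: "coprime u d" "coprime v d'"
    and pos: "a > 0" "b > 0" "a' > 0" "b' > 0"
  shows "a = a'" "b = b'" "d = d' \<Longrightarrow> d dvd u - v"
proof -
  have fst_multiples: "fst ` int_lattice a b d u = {p. a dvd p}" for a b d u
  proof -
    have "p \<in> fst ` int_lattice a b d u" if "a dvd p" for p
    proof -
      obtain x where "p = x * a" using \<open>a dvd p\<close> by (metis dvd_def mult.commute)
      then have "(p, u * x * b) \<in> int_lattice a b d u" by (force simp: int_lattice_def)
      then show ?thesis by (rule image_eqI[rotated]) simp
    qed
    then show ?thesis by (auto simp: int_lattice_def)
  qed
  have snd_multiples: "snd ` int_lattice a b d u = {q. b dvd q}" if "coprime u d" for a b d u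
  proof -
    \<comment> \<open>Every \<open>x\<close> occurs in the first projection, with
      \<open>y = u * x\<close>. For the second, a given \<open>y\<close> must be solved for
      \<open>x\<close>, which takes an inverse of \<open>u\<close> modulo \<open>d\<close>.\<close>
    obtain v where v: "d dvd 1 - u * v"
      using cong_solve_coprime_int[of u d] \<open>coprime u d\<close>
      by (metis cong_iff_dvd_diff dvd_diff_commute)
    have "q \<in> snd ` int_lattice a b d u" if "b dvd q" for q
    proof -
      obtain y where y: "q = y * b" using \<open>b dvd q\<close> by (metis dvd_def mult.commute)
      have "y - u * (v * y) = (1 - u * v) * y" by (simp add: algebra_simps)
      then have "d dvd y - u * (v * y)" using v by simp
      then have "(v * y * a, q) \<in> int_lattice a b d u" unfolding y int_lattice_def by blast
      then show ?thesis by (rule image_eqI[rotated]) simp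
    qed
    then show ?thesis by (auto simp: int_lattice_def)
  qed
  have "{p. a dvd p} = {p. a' dvd p}"
    using eq fst_multiples by metis
  then show a: "a = a'" using pos
    by (metis dvd_refl mem_Collect_eq order_less_imp_le zdvd_antisym_nonneg)
  have "{p. b dvd p} = {p. b' dvd p}"
    using eq snd_multiples cop by metis
  then show b: "b = b'" using pos
    by (metis dvd_refl mem_Collect_eq order_less_imp_le zdvd_antisym_nonneg)
  have "(1 * a, u * b) \<in> int_lattice a b d u"
    unfolding int_lattice_def by force
  then have "(1 * a, u * b) \<in> int_lattice a b d v" if "d = d'"
    using eq a b that by simp
  then show "d dvd u - v" if "d = d'"
    using pos that by (auto simp: int_lattice_def)
qed

section \<open>Counting lattice points in a box\<close>

text \<open>Each of the \<open>i\<close> values of \<open>x\<close> confines \<open>y\<close> to one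
  class modulo \<open>d\<close>, which has \<open>j / d\<close> representatives below
  \<open>j\<close> because \<open>d\<close> divides \<open>j\<close>.\<close>

lemma card_int_lattice_box:
  fixes i j :: nat
  assumes d: "d > 0" "d dvd int i" "d dvd int j" and pos: "a > 0" "b > 0"
  shows "card (int_lattice a b d u \<inter> {0..<int i * a} \<times> {0..<int j * b}) = i * nat (int j div d)"
proof -
  obtain l where l: "int j = d * l" using d by blast
  have lge: "l \<ge> 0" using l d
    by (metis of_nat_0_le_iff zero_le_mult_iff not_less_iff_gr_or_eq less_le_not_le)
  \<comment> \<open>The parameter \<open>t\<close> runs through the residues modulo
    \<open>j = d * l\<close> that lie in the class of \<open>u * x\<close> modulo
    \<open>d\<close>.\<close>
  define f where "f = (\<lambda>(x, t). (x * a, ((u * x + d * t) mod int j) * b))"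
  have "bij_betw f ({0..<int i} \<times> {0..<l}) (int_lattice a b d u \<inter> {0..<int i * a} \<times> {0..<int j * b})"
  proof (rule bij_betwI')
    fix z w assume z: "z \<in> {0..<int i} \<times> {0..<l}" and w: "w \<in> {0..<int i} \<times> {0..<l}"
    obtain x t x' t' where zw: "z = (x, t)" "w = (x', t')" by fastforce
    show "f z = f w \<longleftrightarrow> z = w"
    proof
      assume "f z = f w"
      then have x: "x = x'" and "(u * x + d * t) mod int j = (u * x' + d * t') mod int j"
        using pos by (auto simp: f_def zw)
      then have "d * l dvd d * (t - t')"
        by (simp add: mod_eq_dvd_iff l right_diff_distrib)
      then have "l dvd t - t'" using d by simp
      moreover have "\<bar>t - t'\<bar> < l" using z w zw by auto
      ultimately have "t = t'"
        using dvd_imp_le_int[of "t - t'" l] by fastforce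
      with x zw show "z = w" by simp
    qed simp
  next
    fix z assume z: "z \<in> {0..<int i} \<times> {0..<l}"
    obtain x t where zx: "z = (x, t)" by fastforce
    have jpos: "int j > 0" using z zx l d by auto
    have "d dvd (u * x + d * t) mod int j - u * x"
    proof -
      have "(u * x + d * t) mod int j - u * x = d * (t - l * ((u * x + d * t) div int j))"
        by (simp add: minus_mult_div_eq_mod[symmetric] l algebra_simps)
      then show ?thesis by simp
    qed
    then have "f z \<in> int_lattice a b d u"
      unfolding f_def zx int_lattice_def by auto
    moreover have "f z \<in> {0..<int i * a} \<times> {0..<int j * b}"
      using z zx jpos pos by (simp add: f_def)
    ultimately show "f z \<in> int_lattice a b d u \<inter> {0..<int i * a} \<times> {0..<int j * b}" by blast
  next
    fix w assume w: "w \<in> int_lattice a b d u \<inter> {0..<int i * a} \<times> {0..<int j * b}"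
    then obtain x y where xy: "w = (x * a, y * b)" "d dvd y - u * x"
      unfolding int_lattice_def by blast
    have xr: "0 \<le> x" "x < int i" and yr: "0 \<le> y" "y < int j"
      using w xy(1) pos by (auto simp: zero_le_mult_iff)
    obtain s where s: "y - u * x = d * s" using xy by blast
    have lpos: "l > 0" using yr l d by (metis lge mult_zero_right not_less order_le_less)
    \<comment> \<open>Reducing \<open>s\<close> modulo \<open>l\<close> moves the value by a
      multiple of \<open>d * l = j\<close>, which the remainder in \<open>f\<close> absorbs.\<close>
    have "u * x + d * (s mod l) = y + int j * (- (s div l))"
      using s by (simp add: minus_mult_div_eq_mod[symmetric] l algebra_simps)
    then have "(u * x + d * (s mod l)) mod int j = y"
      using yr by (metis mod_mult_self2 mod_pos_pos_trivial)
    then have "w = f (x, s mod l)" by (simp add: f_def xy)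
    moreover have "(x, s mod l) \<in> {0..<int i} \<times> {0..<l}"
      using xr lpos by simp
    ultimately show "\<exists>z\<in>{0..<int i} \<times> {0..<l}. w = f z" by blast
  qed
  from bij_betw_same_card[OF this] show ?thesis
    using d l by (simp add: card_cartesian_product)
qed

section \<open>Correspondence between subgroups and lattices\<close>

lemma subgroup_integer_mod_groups_diff:
  assumes H: "subgroup H (integer_mod_group m \<times>\<times> integer_mod_group n)"
    and pq: "(p, q) \<in> H" "(p', q') \<in> H"
  shows "((p - p') mod int m, (q - q') mod int n) \<in> H"
proof -
  let ?G = "integer_mod_group m \<times>\<times> integer_mod_group n"
  have c: "p' \<in> carrier (integer_mod_group m)" "q' \<in> carrier (integer_mod_group n)"
    using subgroup.mem_carrier[OF H pq(2)] by auto
  have "(p, q) \<otimes>\<^bsub>?G\<^esub> inv\<^bsub>?G\<^esub> (p', q') \<in> H"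
    using H pq by (meson subgroup.m_closed subgroup.m_inv_closed)
  also have "inv\<^bsub>?G\<^esub> (p', q') = (- p' mod int m, - q' mod int n)"
    using c by (subst inv_DirProd) auto
  also have "(p, q) \<otimes>\<^bsub>?G\<^esub> \<dots> = ((p - p') mod int m, (q - q') mod int n)"
    by (simp add: mod_add_right_eq)
  finally show ?thesis .
qed

text \<open>The subgroup test by differences, in the form that \<open>int_lattice_diff\<close>
  supplies. Positivity of \<open>m\<close> and \<open>n\<close> makes the carrier the finite box;
  \<open>integer_mod_group 0\<close> would be all integers.\<close>

lemma subgroup_integer_mod_groupsI:
  assumes pos: "m > 0" "n > 0"
    and sub: "H \<subseteq> {0..<int m} \<times> {0..<int n}" and ne: "H \<noteq> {}"
    and diff: "\<And>p q p' q'. (p, q) \<in> H \<Longrightarrow> (p', q') \<in> H \<Longrightarrow>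
      ((p - p') mod int m, (q - q') mod int n) \<in> H"
  shows "subgroup H (integer_mod_group m \<times>\<times> integer_mod_group n)"
proof -
  interpret group "integer_mod_group m \<times>\<times> integer_mod_group n"
    by (intro DirProd_group group_integer_mod_group)
  have car: "p \<in> carrier (integer_mod_group m)" "q \<in> carrier (integer_mod_group n)"
    if "(p, q) \<in> H" for p q
    using that sub pos by (auto simp: carrier_integer_mod_group)
  have zero: "(0, 0) \<in> H"
    using ne diff by (metis diff_self ex_in_conv mod_0 surj_pair)
  have neg: "(- p mod int m, - q mod int n) \<in> H" if "(p, q) \<in> H" for p q
    using diff[OF zero that] by simp
  show ?thesis
  proof (rule subgroupI)
    show "H \<subseteq> carrier (integer_mod_group m \<times>\<times> integer_mod_group n)"
      using sub pos by (simp add: carrier_integer_mod_group)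
    show "H \<noteq> {}" by (rule ne)
  next
    fix x assume "x \<in> H"
    moreover obtain p q where x: "x = (p, q)" by (cases x)
    ultimately have "(p, q) \<in> H" by simp
    then show "inv\<^bsub>integer_mod_group m \<times>\<times> integer_mod_group n\<^esub> x \<in> H"
      using neg car by (simp add: x)
  next
    fix x y assume "x \<in> H" "y \<in> H"
    moreover obtain p q p' q' where xy: "x = (p, q)" "y = (p', q')" by (cases x; cases y)
    ultimately have h: "(p, q) \<in> H" "(p', q') \<in> H" by auto
    show "x \<otimes>\<^bsub>integer_mod_group m \<times>\<times> integer_mod_group n\<^esub> y \<in> H"
      using diff[OF h(1) neg[OF h(2)]] by (simp add: xy mod_diff_right_eq)
  qed
qed

lemma subgroup_int_lattice_box:
  assumes pos: "m > 0" "n > 0" and mn: "int m = i * a" "int n = j * b"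
    and d: "d dvd i" "d dvd j"
  shows "subgroup (int_lattice a b d u \<inter> {0..<int m} \<times> {0..<int n})
    (integer_mod_group m \<times>\<times> integer_mod_group n)"
proof (rule subgroup_integer_mod_groupsI[OF pos])
  have "(0, 0) \<in> int_lattice a b d u"
    using int_lattice_periods[OF d, of 0 a 0 b u] by simp
  then show "int_lattice a b d u \<inter> {0..<int m} \<times> {0..<int n} \<noteq> {}"
    using pos by force
next
  fix p q p' q'
  assume "(p, q) \<in> int_lattice a b d u \<inter> {0..<int m} \<times> {0..<int n}"
    and "(p', q') \<in> int_lattice a b d u \<inter> {0..<int m} \<times> {0..<int n}"
  then have "(p - p', q - q') \<in> int_lattice a b d u"
    by (auto intro: int_lattice_diff)
  from int_lattice_mod[OF d this]
  show "((p - p') mod int m, (q - q') mod int n)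
      \<in> int_lattice a b d u \<inter> {0..<int m} \<times> {0..<int n}"
    using pos mn by auto
qed auto

text \<open>The projections of the lifted subgroup give \<open>a\<close> and \<open>b\<close>, its
  section over first coordinate 0 gives \<open>d\<close>, and a point over \<open>a\<close> gives
  \<open>u\<close>. Every point then differs from a multiple of that point by an element of the
  section.\<close>

lemma subgroup_integer_mod_groups_eq_int_lattice:
  assumes pos: "m > 0" "n > 0"
    and H: "subgroup H (integer_mod_group m \<times>\<times> integer_mod_group n)"
  obtains i j a b d u where "int m = i * a" "int n = j * b" "a > 0" "b > 0" "d > 0"
    "d dvd i" "d dvd j" "coprime u d"
    "H = int_lattice a b d u \<inter> {0..<int m} \<times> {0..<int n}"
proof -
  \<comment> \<open>The preimage of \<open>H\<close> under reduction, a subgroup of the integer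
    plane containing all periods.\<close>
  define P where "P p q \<longleftrightarrow> (p mod int m, q mod int n) \<in> H" for p q
  have diff: "P (p - p') (q - q')" if "P p q" "P p' q'" for p q p' q'
    using subgroup_integer_mod_groups_diff[OF H that[unfolded P_def]]
    by (simp add: P_def mod_diff_eq)
  have "(0, 0) \<in> H"
    using subgroup.one_closed[OF H] by simp
  then have zero: "P (x * int m) (y * int n)" for x y by (simp add: P_def)
  have m0: "P (int m) 0" and n0: "P 0 (int n)"
    using zero[of 1 0] zero[of 0 1] by simp_all
  have add: "P (p + p') (q + q')" if "P p q" "P p' q'" for p q p' q'
    using diff[OF that(1) diff[OF zero[of 0 0] that(2)]] by simp
  have nmult: "P (int k * p) (int k * q)" if "P p q" for k p q
  proof (induction k)
    case (Suc k)
    then show ?case using add[OF that Suc] by (simp add: distrib_right)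
  qed (use zero[of 0 0] in simp)
  have mult: "P (k * p) (k * q)" if "P p q" for k p q
  proof (cases "k \<ge> 0")
    case True
    then show ?thesis using nmult[OF that, of "nat k"] by simp
  next
    case False
    then show ?thesis
      using diff[OF zero[of 0 0] nmult[OF that, of "nat (- k)"]] by simp
  qed

  have "\<exists>a > 0. {p. \<exists>q. P p q} = {p. a dvd p}"
  proof (rule int_closed_diff_multiples)
    show "int m \<in> {p. \<exists>q. P p q}" using m0 by blast
    show "x - y \<in> {p. \<exists>q. P p q}" if "x \<in> {p. \<exists>q. P p q}" "y \<in> {p. \<exists>q. P p q}" for x y
      using diff that by blast
    show "int m > 0" using pos by simp
  qed
  then obtain a where a: "a > 0" "\<And>p. (\<exists>q. P p q) \<longleftrightarrow> a dvd p" by blast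
  have "\<exists>b > 0. {q. \<exists>p. P p q} = {q. b dvd q}"
  proof (rule int_closed_diff_multiples)
    show "int n \<in> {q. \<exists>p. P p q}" using n0 by blast
    show "x - y \<in> {q. \<exists>p. P p q}" if "x \<in> {q. \<exists>p. P p q}" "y \<in> {q. \<exists>p. P p q}" for x y
      using diff that by blast
    show "int n > 0" using pos by simp
  qed
  then obtain b where b: "b > 0" "\<And>q. (\<exists>p. P p q) \<longleftrightarrow> b dvd q" by blast
  have "a dvd int m" using a(2) m0 by blast
  then obtain i where i: "int m = i * a" by (metis dvd_def mult.commute)
  have "b dvd int n" using b(2) n0 by blast
  then obtain j where j: "int n = j * b" by (metis dvd_def mult.commute)
  have jpos: "j > 0" using j b(1) pos by (metis of_nat_0_less_iff zero_less_mult_pos2)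

  \<comment> \<open>The section over 0, in units of \<open>b\<close>. It contains \<open>j\<close>
    because \<open>(0, n)\<close> is a period.\<close>
  have "\<exists>d > 0. {y. P 0 (y * b)} = {y. d dvd y}"
  proof (rule int_closed_diff_multiples)
    show "j \<in> {y. P 0 (y * b)}" using n0 j by simp
    show "x - y \<in> {y. P 0 (y * b)}" if "x \<in> {y. P 0 (y * b)}" "y \<in> {y. P 0 (y * b)}" for x y
      using diff[of 0 "x * b" 0 "y * b"] that by (simp add: left_diff_distrib)
    show "j > 0" by (rule jpos)
  qed
  then obtain d where d: "d > 0" "\<And>y. P 0 (y * b) \<longleftrightarrow> d dvd y" by blast
  obtain q where q: "P a q" using a(2)[of a] dvd_refl[of a] by blast
  then have "b dvd q" using b(2) by blast
  then obtain u where u: "P a (u * b)" using q by (metis dvd_def mult.commute)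

  \<comment> \<open>Subtracting \<open>x\<close> times the point \<open>(a, u * b)\<close> moves any
    point into the section over 0.\<close>
  have P_iff: "P (x * a) (y * b) \<longleftrightarrow> d dvd y - u * x" for x y
  proof -
    have ux: "P (x * a) (x * (u * b))" by (rule mult[OF u])
    have eq: "(y - u * x) * b = y * b - x * (u * b)" by (simp add: algebra_simps)
    have "P (x * a) (y * b) \<longleftrightarrow> P 0 ((y - u * x) * b)"
    proof
      assume "P (x * a) (y * b)"
      from diff[OF this ux] show "P 0 ((y - u * x) * b)" by (simp only: eq diff_self)
    next
      assume "P 0 ((y - u * x) * b)"
      from add[OF this ux] show "P (x * a) (y * b)" by (simp only: eq add_0 diff_add_cancel)
    qed
    then show ?thesis by (simp only: d(2))
  qed
  have dj: "d dvd j" using d(2)[of j] n0 j by simp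
  \<comment> \<open>The period \<open>(m, 0)\<close> yields divisibility of \<open>u * i\<close>
    only; coprimality of \<open>u\<close> and \<open>d\<close> will cancel \<open>u\<close>.\<close>
  have "d dvd u * i" using P_iff[of i 0] m0 i by simp
  moreover have cop: "coprime u d"
  proof -
    \<comment> \<open>Since \<open>b\<close> lies in the second projection, some \<open>x\<close>
      satisfies \<open>u * x = 1\<close> modulo \<open>d\<close>, so \<open>u\<close> is a
      unit.\<close>
    obtain p where p: "P p (1 * b)" using b(2)[of b] dvd_refl[of b] by auto
    then obtain x where "p = x * a" using a(2) by (metis dvd_def mult.commute)
    then have dx: "d dvd 1 - u * x" using p P_iff by blast
    show ?thesis
    proof (rule coprimeI)
      fix c assume c: "c dvd u" "c dvd d"
      then have "c dvd (1 - u * x) + u * x" using dx by (meson dvd_add dvd_mult2 dvd_trans)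
      then show "is_unit c" by simp
    qed
  qed
  ultimately have di: "d dvd i"
    by (metis coprime_commute coprime_dvd_mult_right_iff)
  have car: "H \<subseteq> {0..<int m} \<times> {0..<int n}"
    using subgroup.subset[OF H] pos by (simp add: carrier_integer_mod_group)
  have "(p, q) \<in> H \<longleftrightarrow> (p, q) \<in> int_lattice a b d u \<inter> {0..<int m} \<times> {0..<int n}" for p q
  proof -
    have "P p q \<longleftrightarrow> (p, q) \<in> int_lattice a b d u"
    proof
      assume h: "P p q"
      then have "a dvd p" "b dvd q" using a(2) b(2) by blast+
      then obtain x y where "p = x * a" "q = y * b" by (metis dvd_def mult.commute)
      then show "(p, q) \<in> int_lattice a b d u"
        using h P_iff unfolding int_lattice_def by blast
    qed (auto simp: int_lattice_def P_iff)
    moreover have "P p q \<longleftrightarrow> (p, q) \<in> H" if "(p, q) \<in> {0..<int m} \<times> {0..<int n}"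
      using that by (simp add: P_def)
    ultimately show ?thesis using car by blast
  qed
  then have "H = int_lattice a b d u \<inter> {0..<int m} \<times> {0..<int n}" by auto
  with that i j a(1) b(1) d(1) di dj cop show thesis by blast
qed

text \<open>Both lattices have the periods \<open>m\<close> and \<open>n\<close>, so membership of
  any point is decided inside the common box.\<close>

lemma int_lattice_box_eqD:
  assumes pos: "m > 0" "n > 0"
    and mn: "int m = i * a" "int n = j * b" "int m = i' * a'" "int n = j' * b'"
    and d: "d dvd i" "d dvd j" "d' dvd i'" "d' dvd j'"
    and eq: "int_lattice a b d u \<inter> {0..<int m} \<times> {0..<int n} =
      int_lattice a' b' d' v \<inter> {0..<int m} \<times> {0..<int n}"
  shows "int_lattice a b d u = int_lattice a' b' d' v"
proof -
  have "(p, q) \<in> int_lattice a b d u \<longleftrightarrow> (p, q) \<in> int_lattice a' b' d' v" for p q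
  proof -
    have box: "(p mod int m, q mod int n) \<in> {0..<int m} \<times> {0..<int n}"
      using pos by simp
    have "(p, q) \<in> int_lattice a b d u \<longleftrightarrow> (p mod int m, q mod int n) \<in> int_lattice a b d u"
      using int_lattice_mod_iff[OF d(1,2)] mn by simp
    also have "\<dots> \<longleftrightarrow> (p mod int m, q mod int n) \<in> int_lattice a' b' d' v"
      using eq box by blast
    also have "\<dots> \<longleftrightarrow> (p, q) \<in> int_lattice a' b' d' v"
      unfolding mn(3,4) by (rule int_lattice_mod_iff[OF d(3,4)])
    finally show ?thesis .
  qed
  then show ?thesis by auto
qed

section \<open>Arithmetic of the parameters\<close>

text \<open>Writing \<delta> as \<open>i * k\<close> and as \<open>j * l\<close>, and cancelling in
  \<open>d * \<delta> = i * j\<close>, gives \<open>j = d * k\<close> and \<open>i = d * l\<close>.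
  Hence the summation conditions supply a \<open>d\<close> admissible for the lattice and the right
  order.\<close>

lemma mult_div_common_multiple:
  fixes i j \<delta> :: nat
  assumes "\<delta> > 0" "i dvd \<delta>" "j dvd \<delta>" "\<delta> dvd i * j"
  shows "i * j div \<delta> > 0" "i * j div \<delta> dvd i" "i * j div \<delta> dvd j"
    "i * (j div (i * j div \<delta>)) = \<delta>"
proof -
  obtain k where k: "\<delta> = i * k" using assms(2) by (rule dvdE)
  obtain l where l: "\<delta> = j * l" using assms(3) by (rule dvdE)
  have i0: "i > 0" using assms(1) unfolding k by simp
  have j0: "j > 0" using assms(1) unfolding l by simp
  define d where "d = i * j div \<delta>"
  have d: "d * \<delta> = i * j" unfolding d_def using assms(4) by simp
  have "i * (d * k) = d * \<delta>" "j * (d * l) = d * \<delta>"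
    by (simp only: k mult.left_commute, simp only: l mult.left_commute)
  then have "i * (d * k) = i * j" "j * (d * l) = j * i"
    by (simp_all only: d mult.commute[of i j])
  then have j: "j = d * k" and i: "i = d * l" using i0 j0 by simp_all
  have d0: "d > 0" using i i0 by (cases "d = 0") simp_all
  have "j div d = k" unfolding j using d0 by simp
  then have "i * (j div d) = \<delta>" by (simp only: k)
  moreover have "d dvd i" "d dvd j" using i j by (blast intro: dvdI)+
  ultimately show "i * j div \<delta> > 0" "i * j div \<delta> dvd i" "i * j div \<delta> dvd j"
    "i * (j div (i * j div \<delta>)) = \<delta>"
    unfolding d_def[symmetric] using d0 by blast+
qed

text \<open>The remainder of \<open>u\<close> modulo \<open>d\<close> works unless
  \<open>d = 1\<close>: there it is 0, while totatives are positive and the representative must be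
  1.\<close>

lemma totative_representative:
  assumes "d > 0" "coprime u (int d)"
  obtains v where "v \<in> totatives d" "int d dvd u - int v"
proof (cases "d = 1")
  case True
  then have "1 \<in> totatives d" "int d dvd u - int 1" by simp_all
  then show thesis by (rule that)
next
  case False
  define v where "v = nat (u mod int d)"
  have v: "int v = u mod int d" using assms(1) by (simp add: v_def)
  have "coprime (int v) (int d)"
    unfolding v using assms by (simp only: coprime_mod_left_iff of_nat_eq_0_iff neq0_conv)
  then have cop: "coprime v d" by (simp only: coprime_int_iff)
  then have "v \<noteq> 0" using False by (metis coprime_0_left_iff nat_dvd_1_iff_1)
  moreover have "int v < int d" unfolding v using assms(1) by simp
  ultimately have "v \<in> totatives d"
    using cop by (simp add: in_totatives_iff)
  moreover have "int d dvd u - int v"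
    unfolding v by (rule dvd_minus_mod)
  ultimately show thesis by (rule that)
qed

section \<open>Parametrization of the subgroups and the final count\<close>

definition goursat_subgroup :: "nat \<Rightarrow> nat \<Rightarrow> nat \<Rightarrow> (nat \<times> nat) \<times> nat \<Rightarrow> (int \<times> int) set" where
  "goursat_subgroup \<delta> m n = (\<lambda>((i, j), u).
     int_lattice (int (m div i)) (int (n div j)) (int (i * j div \<delta>)) (int u)
       \<inter> {0..<int m} \<times> {0..<int n})"

text \<open>Injectivity recovers first the lattice from its box and then its parameters.
  Surjectivity takes the lattice form of a subgroup and replaces its unit by a totative.\<close>

lemma bij_betw_goursat_subgroup:
  assumes pos: "m > 0" "n > 0" "\<delta> > 0"
  defines "S \<equiv> {(i, j). i dvd gcd m \<delta> \<and> j dvd gcd n \<delta> \<and> \<delta> dvd i * j}"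
  shows "bij_betw (goursat_subgroup \<delta> m n) (SIGMA (i, j):S. totatives (i * j div \<delta>))
    {H. subgroup H (integer_mod_group m \<times>\<times> integer_mod_group n) \<and> card H = \<delta>}"
proof -
  have S: "int m = int i * int (m div i)" "int n = int j * int (n div j)"
      "int (m div i) > 0" "int (n div j) > 0" "i * j div \<delta> > 0"
      "int (i * j div \<delta>) dvd int i" "int (i * j div \<delta>) dvd int j" "i * (j div (i * j div \<delta>)) = \<delta>"
    if ij: "(i, j) \<in> S" for i j
  proof -
    have dv: "i dvd m" "j dvd n" "i dvd \<delta>" "j dvd \<delta>" "\<delta> dvd i * j"
      using ij by (auto simp: S_def)
    then show "int m = int i * int (m div i)" "int n = int j * int (n div j)"
      by (metis dvd_mult_div_cancel of_nat_mult)+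
    show "int (m div i) > 0" "int (n div j) > 0"
      using dv(1,2) pos by (auto elim!: dvdE)
    show "i * j div \<delta> > 0" "int (i * j div \<delta>) dvd int i" "int (i * j div \<delta>) dvd int j"
      "i * (j div (i * j div \<delta>)) = \<delta>"
      using mult_div_common_multiple[OF pos(3) dv(3-5)] by (simp_all only: int_dvd_int_iff)
  qed
  show ?thesis
  proof (rule bij_betwI')
    fix z w
    assume "z \<in> (SIGMA (i, j):S. totatives (i * j div \<delta>))"
      and "w \<in> (SIGMA (i, j):S. totatives (i * j div \<delta>))"
    then obtain i j u i' j' v where z: "z = ((i, j), u)" "(i, j) \<in> S" "u \<in> totatives (i * j div \<delta>)"
      and w: "w = ((i', j'), v)" "(i', j') \<in> S" "v \<in> totatives (i' * j' div \<delta>)"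
      by auto
    note Sz = S[OF z(2)] and Sw = S[OF w(2)]
    show "goursat_subgroup \<delta> m n z = goursat_subgroup \<delta> m n w \<longleftrightarrow> z = w"
    proof
      assume "goursat_subgroup \<delta> m n z = goursat_subgroup \<delta> m n w"
      then have box: "int_lattice (int (m div i)) (int (n div j)) (int (i * j div \<delta>)) (int u)
          \<inter> {0..<int m} \<times> {0..<int n} =
        int_lattice (int (m div i')) (int (n div j')) (int (i' * j' div \<delta>)) (int v)
          \<inter> {0..<int m} \<times> {0..<int n}"
        by (simp only: goursat_subgroup_def z(1) w(1) prod.case)
      note eq = int_lattice_box_eqD[OF pos(1,2) Sz(1,2) Sw(1,2) Sz(6,7) Sw(6,7) box]
      have cop: "coprime (int u) (int (i * j div \<delta>))" "coprime (int v) (int (i' * j' div \<delta>))"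
        using z(3) w(3) unfolding coprime_int_iff by (simp_all add: in_totatives_iff)
      note D = int_lattice_eqD[OF eq cop Sz(3,4) Sw(3,4)]
      have "int i * int (m div i) = int i' * int (m div i)"
        using Sz(1) Sw(1) D(1) by metis
      then have i: "i = i'" using Sz(3) by simp
      have "int j * int (n div j) = int j' * int (n div j)"
        using Sz(2) Sw(2) D(2) by metis
      then have j: "j = j'" using Sz(4) by simp
      have "int (i * j div \<delta>) dvd int u - int v"
        using D(3) i j by simp
      \<comment> \<open>Totatives lie between 1 and the modulus, so congruent ones coincide.\<close>
      moreover have "\<bar>int u - int v\<bar> < int (i * j div \<delta>)"
        using z(3) w(3) unfolding i j in_totatives_iff by linarith
      ultimately have "int u - int v = 0"
        using dvd_imp_le_int[of "int u - int v" "int (i * j div \<delta>)"] by fastforce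
      then show "z = w" using z(1) w(1) i j by simp
    qed simp
  next
    fix z assume "z \<in> (SIGMA (i, j):S. totatives (i * j div \<delta>))"
    then obtain i j u where z: "z = ((i, j), u)" "(i, j) \<in> S" by auto
    note Sz = S[OF z(2)]
    have "card (goursat_subgroup \<delta> m n z) = \<delta>"
      using card_int_lattice_box[OF _ Sz(6,7,3,4), of "int u"] Sz(5,8)
      unfolding goursat_subgroup_def z(1) prod.case Sz(1,2)[symmetric]
      by (simp only: zdiv_int[symmetric] nat_int of_nat_0_less_iff)
    moreover have "subgroup (goursat_subgroup \<delta> m n z) (integer_mod_group m \<times>\<times> integer_mod_group n)"
      unfolding goursat_subgroup_def z(1) prod.case
      by (rule subgroup_int_lattice_box[OF pos(1,2) Sz(1,2,6,7)])
    ultimately show "goursat_subgroup \<delta> m n z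
        \<in> {H. subgroup H (integer_mod_group m \<times>\<times> integer_mod_group n) \<and> card H = \<delta>}"
      by blast
  next
    fix H assume "H \<in> {H. subgroup H (integer_mod_group m \<times>\<times> integer_mod_group n) \<and> card H = \<delta>}"
    then have H: "subgroup H (integer_mod_group m \<times>\<times> integer_mod_group n)" "card H = \<delta>" by auto
    obtain i' j' a' b' d' u where L: "int m = i' * a'" "int n = j' * b'" "a' > 0" "b' > 0" "d' > 0"
      "d' dvd i'" "d' dvd j'" "coprime u d'"
      "H = int_lattice a' b' d' u \<inter> {0..<int m} \<times> {0..<int n}"
      by (rule subgroup_integer_mod_groups_eq_int_lattice[OF pos(1,2) H(1)])
    have ij_pos: "i' > 0" "j' > 0"
      using L(1-4) pos by (metis of_nat_0_less_iff zero_less_mult_pos2)+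
    define i j a b d where "i = nat i'" "j = nat j'" "a = nat a'" "b = nat b'" "d = nat d'"
    then have c: "i' = int i" "j' = int j" "a' = int a" "b' = int b" "d' = int d"
      using L(3-5) ij_pos by auto
    have N: "m = i * a" "n = j * b" "d > 0" "d dvd i" "d dvd j" "i > 0" "j > 0" "a > 0" "b > 0"
      using L(1-7) ij_pos unfolding c
      by (simp_all only: int_dvd_int_iff of_nat_mult[symmetric] of_nat_eq_iff of_nat_0_less_iff)
    have "card H = i * nat (int j div int d)"
      using card_int_lattice_box[of "int d" i j a' b' u] L unfolding c by simp
    then have card: "\<delta> = i * (j div d)"
      using H(2) by (simp only: zdiv_int[symmetric] nat_int)
    \<comment> \<open>These cofactors give \<open>\<delta> = d * k * l\<close>, so \<open>i\<close>
      and \<open>j\<close> divide \<delta>, and \<open>i * j = d * \<delta>\<close> identifies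
      \<open>d\<close> with the modulus prescribed by \<open>(i, j)\<close>.\<close>
    obtain k l where kl: "i = d * k" "j = d * l" using N(4,5) by blast
    then have \<delta>: "\<delta> = d * k * l" using card N(3) by simp
    have ij: "i * j = d * \<delta>" unfolding \<delta> kl by simp
    have "(i, j) \<in> S"
      unfolding S_def using N(1,2) by (simp add: ij) (simp add: \<delta> kl)
    moreover have d: "i * j div \<delta> = d" using ij pos(3) by simp
    moreover obtain v where v: "v \<in> totatives d" "int d dvd u - int v"
      using totative_representative[OF N(3)] L(8) c(5) by metis
    ultimately have "((i, j), v) \<in> (SIGMA (i, j):S. totatives (i * j div \<delta>))" by simp
    moreover have "H = goursat_subgroup \<delta> m n ((i, j), v)"
    proof -
      have "m div i = a" "n div j = b" using N by simp_all
      then show ?thesis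
        unfolding goursat_subgroup_def prod.case d L(9) c using int_lattice_cong[OF v(2)] by simp
    qed
    ultimately show "\<exists>z\<in>(SIGMA (i, j):S. totatives (i * j div \<delta>)). H = goursat_subgroup \<delta> m n z"
      by blast
  qed
qed

theorem theorem4p3:
  fixes m n \<delta> :: nat
  assumes "m \<ge> 1" and "n \<ge> 1" and "\<delta> \<ge> 1" and "\<delta> dvd m * n"
  shows "subgroup_count \<delta> m n =
    (\<Sum>(i, j) \<in> {(i, j). i dvd gcd m \<delta> \<and> j dvd gcd n \<delta> \<and> \<delta> dvd i * j}.
       totient (i * j div \<delta>))"
proof -
  let ?S = "{(i, j). i dvd gcd m \<delta> \<and> j dvd gcd n \<delta> \<and> \<delta> dvd i * j}"
  \<comment> \<open>Both entries divide the positive number \<delta>. Finiteness of the index set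
    lets the cardinality of the dependent sum split into totients.\<close>
  have "?S \<subseteq> {..\<delta>} \<times> {..\<delta>}"
    using assms(3) by (auto intro!: dvd_imp_le)
  then have fin: "finite ?S" by (rule finite_subset) simp
  have "subgroup_count \<delta> m n = card (SIGMA (i, j):?S. totatives (i * j div \<delta>))"
    unfolding subgroup_count_def
    using bij_betw_same_card[OF bij_betw_goursat_subgroup[of m n \<delta>]] assms(1-3) by simp
  also have "\<dots> = (\<Sum>(i, j) \<in> ?S. totient (i * j div \<delta>))"
    using fin by (subst card_SigmaI) (auto simp: totient_def case_prod_beta)
  finally show ?thesis .
qed

end
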